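(* Let $v$ be a valuation on a field $F$ with value group $\Gamma_v$ and valuation ring $O_v$, and let $R$ be an algebra over $O_v$. Let $\mathcal M(\Gamma_v)$ be the cut monoid of $\Gamma_v$. Then there exists a quasi-valuation $w:R\to\mathcal M(\Gamma_v)\cup\{\infty\}$ induced by $(R,v)$; that is, the function $w$ given by $w(0)=\infty$ and $w(x)=v(S_x)^+$ for $0\ne x\in R$, where $S_x=\{a\in O_v\mid xR\subseteq aR\}$ and $v(S_x)=\{v(a)\mid a\in S_x\}$, is a quasi-valuation on $R$.
   Context: A totally ordered abelian monoid is a commutative monoid $(M,+)$ with a total order such that $a\le b$ implies $a+c\le b+c$. One adjoins $\infty$, greater than all elements of $M$, with $m+\infty=\infty$. A quasi-valuation on a ring $A$ is a function $w:A\to M\cup\{\infty\}$, $M$ a totally ordered abelian monoid, with $w(0)=\infty$, $w(xy)\ge w(x)+w(y)$ and $w(x+y)\ge\min\{w(x),w(y)\}$ for all $x,y\in A$. Cut monoid. For a totally ordered abelian group $\Gamma$, a cut $\mathcal A=(\mathcal A^L,\mathcal A^R)$ is a partition of $\Gamma$ into two (possibly empty) subsets with $\alpha<\beta$ for all $\alpha\in\mathcal A^L,\beta\in\mathcal A^R$. $\mathcal M(\Gamma)$ is the set of all cuts, ordered by $\mathcal A\le\mathcal B$ iff $\mathcal A^L\subseteq\mathcal B^L$, with addition $(\mathcal A+\mathcal B)^L=\{\alpha+\beta\mid\alpha\in\mathcal A^L,\beta\in\mathcal B^L\}$; it is a totally ordered abelian monoid with zero element $((-\infty,0],(0,\infty))$.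 For $S\subseteq\Gamma$, $S^+$ is the smallest cut $\mathcal A$ with $S\subseteq\mathcal A^L$. The adjoined $\infty$ is different from (and greater than) the cut $(\Gamma,\emptyset)$. Algebras are associative with $1$, not necessarily commutative, not necessarily faithful over $O_v$. *)

theory Defs
  imports Main
begin

section \<open>Adjoining a greatest element\<close>

datatype 'a with_infty = Fin 'a | Infty

instantiation with_infty :: (linorder) linorder
begin

definition less_eq_with_infty :: "'a with_infty \<Rightarrow> 'a with_infty \<Rightarrow> bool" where
  "x \<le> y \<longleftrightarrow> (case y of Infty \<Rightarrow> True | Fin b \<Rightarrow> (case x of Infty \<Rightarrow> False | Fin a \<Rightarrow> a \<le> b))"

definition less_with_infty :: "'a with_infty \<Rightarrow> 'a with_infty \<Rightarrow> bool" where
  "x < y \<longleftrightarrow> (case x of Infty \<Rightarrow> False | Fin a \<Rightarrow> (case y of Infty \<Rightarrow> True | Fin b \<Rightarrow> a < b))"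

instance
  by standard
    (auto simp: less_eq_with_infty_def less_with_infty_def less_le_not_le intro: order_trans
      split: with_infty.splits)

end

instantiation with_infty :: (comm_monoid_add) comm_monoid_add
begin

definition zero_with_infty :: "'a with_infty" where
  "0 = Fin 0"

definition plus_with_infty :: "'a with_infty \<Rightarrow> 'a with_infty \<Rightarrow> 'a with_infty" where
  "x + y = (case x of Infty \<Rightarrow> Infty | Fin a \<Rightarrow> (case y of Infty \<Rightarrow> Infty | Fin b \<Rightarrow> Fin (a + b)))"

instance
  by standard
    (auto simp: zero_with_infty_def plus_with_infty_def ac_simps
      split: with_infty.splits)

end

instance with_infty :: ("{ordered_comm_monoid_add, linorder}") ordered_comm_monoid_add
  by standard
    (auto simp: less_eq_with_infty_def plus_with_infty_def add_left_mono
      split: with_infty.splits)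

lemma with_infty_simps [simp]:
  "x \<le> Infty"
  "\<not> Infty \<le> Fin m"
  "Fin m \<le> Fin n \<longleftrightarrow> m \<le> n"
  "x + Infty = Infty"
  "Infty + x = Infty"
  "Fin k + Fin l = Fin (k + l)"
  by (auto simp: less_eq_with_infty_def plus_with_infty_def split: with_infty.splits)


section \<open>The cut monoid\<close>

typedef (overloaded) ('a::linorder) cut =
  "{(L, R). L \<union> R = (UNIV :: 'a set) \<and> L \<inter> R = {} \<and> (\<forall>\<alpha>\<in>L. \<forall>\<beta>\<in>R. \<alpha> < \<beta>)}"
  by (rule exI[of _ "({}, UNIV)"]) simp

definition cut_left :: "'a::linorder cut \<Rightarrow> 'a set" where
  "cut_left A = fst (Rep_cut A)"

definition cut_right :: "'a::linorder cut \<Rightarrow> 'a set" where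
  "cut_right A = snd (Rep_cut A)"

text \<open>The cut with left part \<open>L\<close>; meaningful only for downward closed \<open>L\<close>.\<close>

definition cut_of_left :: "'a::linorder set \<Rightarrow> 'a cut" where
  "cut_of_left L = Abs_cut (L, - L)"

lemma cut_partition:
  "cut_left A \<union> cut_right A = UNIV" "cut_left A \<inter> cut_right A = {}"
  "\<alpha> \<in> cut_left A \<Longrightarrow> \<beta> \<in> cut_right A \<Longrightarrow> \<alpha> < \<beta>"
  using Rep_cut[of A] by (auto simp: cut_left_def cut_right_def split: prod.splits)

lemma cut_right_eq: "cut_right A = - cut_left A"
  using cut_partition(1,2)[of A] by blast

lemma cut_left_downward: "\<alpha> \<in> cut_left A \<Longrightarrow> \<beta> \<le> \<alpha> \<Longrightarrow> \<beta> \<in> cut_left A"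
  using cut_partition(3)[of \<alpha> A \<beta>] by (fastforce simp: cut_right_eq)

lemma cut_eqI: "cut_left A = cut_left B \<Longrightarrow> A = B"
  by (metis Rep_cut_inject cut_left_def cut_right_def cut_right_eq prod_eqI)

lemma cut_left_of_left:
  assumes "\<And>\<alpha> \<beta>. \<alpha> \<in> L \<Longrightarrow> \<beta> \<le> \<alpha> \<Longrightarrow> \<beta> \<in> L"
  shows "cut_left (cut_of_left L) = L"
proof -
  have "\<alpha> < \<beta>" if "\<alpha> \<in> L" "\<beta> \<in> - L" for \<alpha> \<beta>
    using assms[OF that(1), of \<beta>] that(2) by (meson ComplD not_less)
  then show ?thesis
    unfolding cut_left_def cut_of_left_def by (subst Abs_cut_inverse) auto
qed

instantiation cut :: (linorder) linorder
begin

definition less_eq_cut :: "'a cut \<Rightarrow> 'a cut \<Rightarrow> bool" where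
  "A \<le> B \<longleftrightarrow> cut_left A \<subseteq> cut_left B"

definition less_cut :: "'a cut \<Rightarrow> 'a cut \<Rightarrow> bool" where
  "A < B \<longleftrightarrow> cut_left A \<subset> cut_left B"

instance
proof
  fix A B :: "'a cut"
  show "A \<le> B \<or> B \<le> A"
    unfolding less_eq_cut_def by (meson cut_left_downward linear subsetI)
qed (auto simp: less_eq_cut_def less_cut_def intro: cut_eqI)

end

instantiation cut :: (linordered_ab_group_add) comm_monoid_add
begin

definition zero_cut :: "'a cut" where
  "0 = cut_of_left {..0}"

definition plus_cut :: "'a cut \<Rightarrow> 'a cut \<Rightarrow> 'a cut" where
  "A + B = cut_of_left {\<alpha> + \<beta> |\<alpha> \<beta>. \<alpha> \<in> cut_left A \<and> \<beta> \<in> cut_left B}"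

lemma cut_left_zero: "cut_left (0 :: 'a cut) = {..0}"
  unfolding zero_cut_def by (rule cut_left_of_left) auto

lemma cut_left_plus:
  "cut_left (A + B) = {\<alpha> + \<beta> |\<alpha> \<beta>. \<alpha> \<in> cut_left A \<and> \<beta> \<in> cut_left B}"
  for A B :: "'a cut"
  unfolding plus_cut_def
proof (rule cut_left_of_left)
  fix \<gamma> \<delta> :: 'a
  assume "\<gamma> \<in> {\<alpha> + \<beta> |\<alpha> \<beta>. \<alpha> \<in> cut_left A \<and> \<beta> \<in> cut_left B}" and le: "\<delta> \<le> \<gamma>"
  then obtain \<alpha> \<beta> where *: "\<gamma> = \<alpha> + \<beta>" "\<alpha> \<in> cut_left A" "\<beta> \<in> cut_left B" by blast
  have "\<delta> - \<beta> \<le> \<alpha>" using le *(1) by (simp add: diff_le_eq)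
  then have "\<delta> - \<beta> \<in> cut_left A" using cut_left_downward *(2) by blast
  moreover have "\<delta> = (\<delta> - \<beta>) + \<beta>" by simp
  ultimately show "\<delta> \<in> {\<alpha> + \<beta> |\<alpha> \<beta>. \<alpha> \<in> cut_left A \<and> \<beta> \<in> cut_left B}" using *(3) by blast
qed

instance
proof
  fix A B C :: "'a cut"
  show "A + B + C = A + (B + C)"
  proof (rule cut_eqI, rule set_eqI)
    fix x
    show "x \<in> cut_left (A + B + C) \<longleftrightarrow> x \<in> cut_left (A + (B + C))"
      unfolding cut_left_plus by (auto; metis add.assoc)
  qed
  show "A + B = B + A"
    by (rule cut_eqI) (auto simp: cut_left_plus; metis add.commute)
  show "0 + A = A"
  proof (rule cut_eqI, rule set_eqI)
    fix x
    have "x \<in> cut_left A" if "\<alpha> \<le> 0" "\<beta> \<in> cut_left A" "x = \<alpha> + \<beta>" for \<alpha> \<beta>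
      using that cut_left_downward[of \<beta> A x] by simp
    moreover have "\<exists>\<alpha> \<beta>. x = \<alpha> + \<beta> \<and> \<alpha> \<le> 0 \<and> \<beta> \<in> cut_left A" if "x \<in> cut_left A"
      using that by (intro exI[of _ 0] exI[of _ x]) simp
    ultimately show "x \<in> cut_left (0 + A) \<longleftrightarrow> x \<in> cut_left A"
      by (auto simp: cut_left_plus cut_left_zero)
  qed
qed

end

instance cut :: (linordered_ab_group_add) ordered_comm_monoid_add
  by standard (auto simp: less_eq_cut_def cut_left_plus)

text \<open>This is \<open>S\<^sup>+\<close>.\<close>

definition cut_plus :: "'a::linorder set \<Rightarrow> 'a cut" where
  "cut_plus S = (LEAST A. S \<subseteq> cut_left A)"

text \<open>A smallest cut with \<open>S\<close> in its left part always exists.\<close>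

lemma cut_left_cut_plus: "cut_left (cut_plus S) = {\<gamma>. \<exists>\<sigma>\<in>S. \<gamma> \<le> \<sigma>}"
proof -
  let ?D = "{\<gamma>. \<exists>\<sigma>\<in>S. \<gamma> \<le> \<sigma>}"
  have left: "cut_left (cut_of_left ?D) = ?D"
    by (rule cut_left_of_left) (auto intro: order_trans)
  have "cut_plus S = cut_of_left ?D"
    unfolding cut_plus_def
  proof (rule Least_equality)
    show "S \<subseteq> cut_left (cut_of_left ?D)" unfolding left by auto
    show "cut_of_left ?D \<le> B" if "S \<subseteq> cut_left B" for B
      using that unfolding less_eq_cut_def left by (auto intro: cut_left_downward)
  qed
  then show ?thesis using left by simp
qed


section \<open>Valuations and quasi-valuations\<close>

text \<open>
  Surjectivity onto the finite values says that the type \<open>'g\<close> is the value group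
  of \<open>v\<close>, rather than an ordered group properly containing it.
\<close>

locale valuation =
  fixes v :: "'f::field \<Rightarrow> 'g::linordered_ab_group_add with_infty"
  assumes v_eq_Infty_iff: "v a = Infty \<longleftrightarrow> a = 0"
    and v_mult: "v (a * b) = v a + v b"
    and v_add: "v (a + b) \<ge> min (v a) (v b)"
    and v_surj: "\<exists>a. v a = Fin \<gamma>"

definition valuation_ring :: "('f \<Rightarrow> 'g::linordered_ab_group_add with_infty) \<Rightarrow> 'f set" where
  "valuation_ring v = {a. v a \<ge> 0}"

definition quasi_valuation ::
    "('r::ring \<Rightarrow> 'm::{ordered_comm_monoid_add, linorder} with_infty) \<Rightarrow> bool" where
  "quasi_valuation w \<longleftrightarrow>
     w 0 = Infty \<and>
     (\<forall>x y. w (x * y) \<ge> w x + w y) \<and>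
     (\<forall>x y. w (x + y) \<ge> min (w x) (w y))"


section \<open>Algebras over a subring of a field\<close>

text \<open>
  The scalars are the elements of \<open>S\<close>; the values of \<open>scale\<close> outside \<open>S\<close> are irrelevant.
  The sort \<open>{ring, monoid_mult}\<close> describes associative rings with \<open>1\<close>; unlike \<open>ring_1\<close>
  it does not exclude the zero ring.
\<close>

locale algebra_over =
  fixes S :: "'f::field set"
    and scale :: "'f \<Rightarrow> 'r::{ring, monoid_mult} \<Rightarrow> 'r"
  assumes scale_add_right: "a \<in> S \<Longrightarrow> scale a (x + y) = scale a x + scale a y"
    and scale_add_left: "a \<in> S \<Longrightarrow> b \<in> S \<Longrightarrow> scale (a + b) x = scale a x + scale b x"
    and scale_scale: "a \<in> S \<Longrightarrow> b \<in> S \<Longrightarrow> scale (a * b) x = scale a (scale b x)"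
    and scale_one: "scale 1 x = x"
    and scale_mult_left: "a \<in> S \<Longrightarrow> scale a (x * y) = scale a x * y"
    and scale_mult_right: "a \<in> S \<Longrightarrow> scale a (x * y) = x * scale a y"


section \<open>The function induced by an algebra and a valuation\<close>

definition support_set ::
    "('f \<Rightarrow> 'g::linordered_ab_group_add with_infty) \<Rightarrow> ('f \<Rightarrow> 'r::ring \<Rightarrow> 'r) \<Rightarrow> 'r \<Rightarrow> 'f set" where
  "support_set v scale x =
     {a \<in> valuation_ring v. range (\<lambda>r. x * r) \<subseteq> range (\<lambda>r. scale a r)}"

text \<open>
  For \<open>x \<noteq> 0\<close> the set \<open>S\<^sub>x\<close> does not contain \<open>0\<close>, so restricting to finite values
  in \<open>v(S\<^sub>x)\<close> discards nothing; see \<open>support_set_finite_value\<close> below.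
\<close>

definition finite_values :: "('f \<Rightarrow> 'g with_infty) \<Rightarrow> 'f set \<Rightarrow> 'g set" where
  "finite_values v S = {\<gamma>. \<exists>a\<in>S. v a = Fin \<gamma>}"

definition induced_quasi_valuation ::
    "('f \<Rightarrow> 'g::linordered_ab_group_add with_infty) \<Rightarrow> ('f \<Rightarrow> 'r::ring \<Rightarrow> 'r) \<Rightarrow>
     'r \<Rightarrow> 'g cut with_infty" where
  "induced_quasi_valuation v scale x =
     (if x = 0 then Infty else Fin (cut_plus (finite_values v (support_set v scale x))))"

lemma support_set_finite_value:
  fixes v :: "'f::field \<Rightarrow> 'g::linordered_ab_group_add with_infty"
    and scale :: "'f \<Rightarrow> 'r::{ring, monoid_mult} \<Rightarrow> 'r"
  assumes "valuation v" and "algebra_over (valuation_ring v) scale"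
    and "x \<noteq> 0" and "a \<in> support_set v scale x"
  shows "v a \<noteq> Infty"
proof
  assume "v a = Infty"
  then have "a = 0" using assms(1) by (simp add: valuation.v_eq_Infty_iff)
  have "0 \<in> valuation_ring v"
    using assms(1) by (simp add: valuation_ring_def valuation.v_eq_Infty_iff[THEN iffD2])
  then have "scale (0 + 0) r = scale 0 r + scale 0 r" for r
    using assms(2) by (intro algebra_over.scale_add_left)
  then have "scale 0 r = 0" for r by simp
  moreover have "x * 1 \<in> range (\<lambda>r. scale a r)"
    using assms(4) unfolding support_set_def by blast
  ultimately show False using \<open>x \<noteq> 0\<close> \<open>a = 0\<close> by auto
qed

end

theory Submission
  imports Defs
begin

text \<open>
  The sets \<open>S\<^sub>x\<close> satisfy \<open>S\<^sub>x S\<^sub>y \<subseteq> S\<^bsub>xy\<^esub>\<close>, because scalars are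
  central, and \<open>S\<^sub>x \<inter> S\<^sub>y \<subseteq> S\<^bsub>x+y\<^esub>\<close>. The first inclusion gives
  \<open>w(xy) \<ge> w(x) + w(y)\<close>. For the sum, \<open>S\<^sub>x\<close> is closed under passing to scalars of smaller
  value, so of \<open>a \<in> S\<^sub>x\<close> and \<open>b \<in> S\<^sub>y\<close> the one of smaller value lies in both sets.
\<close>

text \<open>Turns inequalities between cuts into the search for a single scalar in \<open>S\<close>.
  Keeping the bound as \<open>Fin \<gamma> \<le> v a\<close> lets it be added and multiplied inside
  \<open>with_infty\<close>; the condition \<open>v a \<noteq> Infty\<close> keeps a zero scalar
  from witnessing every \<open>\<gamma>\<close>.\<close>

lemma cut_left_cut_plus_finite_values:
  fixes v :: "'f \<Rightarrow> 'g::linordered_ab_group_add with_infty"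
  shows "cut_left (cut_plus (finite_values v S)) = {\<gamma>. \<exists>a\<in>S. v a \<noteq> Infty \<and> Fin \<gamma> \<le> v a}"
proof -
  have "(\<exists>\<sigma>. v a = Fin \<sigma> \<and> \<gamma> \<le> \<sigma>) \<longleftrightarrow> v a \<noteq> Infty \<and> Fin \<gamma> \<le> v a" for a \<gamma>
    by (cases "v a") auto
  then show ?thesis
    unfolding cut_left_cut_plus finite_values_def by blast
qed

lemma (in valuation) quotient_in_valuation_ring:
  assumes "c \<noteq> 0" and "v c \<le> v a"
  shows "a / c \<in> valuation_ring v"
proof -
  obtain \<gamma> where c: "v c = Fin \<gamma>"
    using assms(1) v_eq_Infty_iff[of c] by (cases "v c") auto
  \<comment> \<open>As \<open>v c\<close> is finite, it can be cancelled when this is compared with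
    \<open>v c \<le> v a\<close>.\<close>
  have a: "v a = v (a / c) + v c"
    using assms(1) by (simp flip: v_mult)
  show ?thesis
    using assms(2) a c by (cases "v (a / c)") (auto simp: valuation_ring_def zero_with_infty_def)
qed

lemma (in valuation) mult_in_valuation_ring:
  assumes "a \<in> valuation_ring v" and "b \<in> valuation_ring v"
  shows "a * b \<in> valuation_ring v"
  using assms by (simp add: valuation_ring_def v_mult add_nonneg_nonneg)

locale valued_algebra =
  valuation v + algebra_over "valuation_ring v" scale
  for v :: "'f::field \<Rightarrow> 'g::linordered_ab_group_add with_infty"
    and scale :: "'f \<Rightarrow> 'r::{ring, monoid_mult} \<Rightarrow> 'r"
begin

text \<open>Since \<open>a = c * (a / c)\<close> with \<open>a / c\<close> in the valuation ring,
  \<open>aR\<close> is contained in \<open>cR\<close>.\<close>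

lemma support_set_antimono:
  assumes a: "a \<in> support_set v scale x" and c: "c \<in> valuation_ring v" and le: "v c \<le> v a"
  shows "c \<in> support_set v scale x"
proof (cases "c = 0")
  \<comment> \<open>The factorization through \<open>a / c\<close> breaks down here, but
    \<open>v c = Infty\<close> forces \<open>a\<close> to be zero as well.\<close>
  case True
  then have "v a = Infty"
    using le v_eq_Infty_iff[of c] by (cases "v a") auto
  then have "a = c"
    using True v_eq_Infty_iff by simp
  then show ?thesis
    using a by simp
next
  case False
  have "scale a r = scale c (scale (a / c) r)" for r
    using scale_scale[OF c quotient_in_valuation_ring[OF False le], of r] False by simp
  then have "range (scale a) \<subseteq> range (scale c)"
    by auto
  then show ?thesis
    using a c unfolding support_set_def by blast
qed

lemma support_set_mult:
  assumes a: "a \<in> support_set v scale x" and b: "b \<in> support_set v scale y"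
  shows "a * b \<in> support_set v scale (x * y)"
proof -
  have aO: "a \<in> valuation_ring v" and bO: "b \<in> valuation_ring v"
    using a b by (auto simp: support_set_def)
  have "x * y * r \<in> range (scale (a * b))" for r
  proof -
    obtain s where s: "y * r = scale b s"
      using b unfolding support_set_def by blast
    obtain t where t: "x * s = scale a t"
      using a unfolding support_set_def by blast
    \<comment> \<open>Centrality: the scalar \<open>b\<close> is pulled out to the left of
      \<open>x\<close>, which leaves \<open>x * s\<close> to be absorbed by
      \<open>a\<close>.\<close>
    have "x * y * r = scale b (x * s)"
      using s scale_mult_right[OF bO, of x s] by (simp add: mult.assoc)
    also have "\<dots> = scale (a * b) t"
      using scale_scale[OF bO aO, of t] t by (simp add: mult.commute)
    finally show ?thesis by simp
  qed
  then show ?thesis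
    using mult_in_valuation_ring[OF aO bO] unfolding support_set_def by blast
qed

lemma support_set_add:
  assumes a: "a \<in> support_set v scale x" and b: "a \<in> support_set v scale y"
  shows "a \<in> support_set v scale (x + y)"
proof -
  have aO: "a \<in> valuation_ring v"
    using a by (simp add: support_set_def)
  have "(x + y) * r \<in> range (scale a)" for r
  proof -
    obtain s where s: "x * r = scale a s"
      using a unfolding support_set_def by blast
    obtain t where t: "y * r = scale a t"
      using b unfolding support_set_def by blast
    have "(x + y) * r = scale a (s + t)"
      using s t scale_add_right[OF aO] by (simp add: distrib_right)
    then show ?thesis by simp
  qed
  then show ?thesis
    using aO unfolding support_set_def by blast
qed

lemma induced_quasi_valuation_mult:
  "induced_quasi_valuation v scale x + induced_quasi_valuation v scale y
    \<le> induced_quasi_valuation v scale (x * y)"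
proof (cases "x * y = 0")
  case True
  then show ?thesis by (simp add: induced_quasi_valuation_def)
next
  case False
  let ?A = "\<lambda>z. cut_plus (finite_values v (support_set v scale z))"
  have "\<alpha> + \<beta> \<in> cut_left (?A (x * y))" if \<alpha>: "\<alpha> \<in> cut_left (?A x)" and \<beta>: "\<beta> \<in> cut_left (?A y)"
    for \<alpha> \<beta>
  proof -
    obtain a where a: "a \<in> support_set v scale x" "v a \<noteq> Infty" "Fin \<alpha> \<le> v a"
      using \<alpha> unfolding cut_left_cut_plus_finite_values by blast
    obtain b where b: "b \<in> support_set v scale y" "v b \<noteq> Infty" "Fin \<beta> \<le> v b"
      using \<beta> unfolding cut_left_cut_plus_finite_values by blast
    \<comment> \<open>Finite values mean that both factors are nonzero, and a field has no zero
      divisors.\<close>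
    have "v (a * b) \<noteq> Infty"
      using a(2) b(2) by (simp add: v_eq_Infty_iff)
    moreover have "Fin (\<alpha> + \<beta>) \<le> v (a * b)"
      using add_mono[OF a(3) b(3)] by (simp add: v_mult)
    ultimately show ?thesis
      using support_set_mult[OF a(1) b(1)] unfolding cut_left_cut_plus_finite_values by blast
  qed
  then have "?A x + ?A y \<le> ?A (x * y)"
    unfolding less_eq_cut_def cut_left_plus by blast
  \<comment> \<open>Hence all three values are genuine cuts rather than
    \<open>Infty\<close>.\<close>
  moreover have "x \<noteq> 0" "y \<noteq> 0"
    using False by auto
  ultimately show ?thesis
    using False by (simp add: induced_quasi_valuation_def)
qed

lemma induced_quasi_valuation_add:
  "min (induced_quasi_valuation v scale x) (induced_quasi_valuation v scale y)
    \<le> induced_quasi_valuation v scale (x + y)"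
proof (cases "x = 0 \<or> y = 0 \<or> x + y = 0")
  case True
  \<comment> \<open>A zero summand leaves the other summand as the sum; a zero sum has value
    \<open>Infty\<close>.\<close>
  then show ?thesis by (auto simp: induced_quasi_valuation_def)
next
  case False
  let ?A = "\<lambda>z. cut_plus (finite_values v (support_set v scale z))"
  \<comment> \<open>Left parts of cuts are nested, so the left part of the minimum is the
    intersection of the two.\<close>
  have "\<gamma> \<in> cut_left (?A (x + y))" if \<gamma>: "\<gamma> \<in> cut_left (?A x)" "\<gamma> \<in> cut_left (?A y)" for \<gamma>
  proof -
    obtain a where a: "a \<in> support_set v scale x" "v a \<noteq> Infty" "Fin \<gamma> \<le> v a"
      using \<gamma> unfolding cut_left_cut_plus_finite_values by blast
    obtain b where b: "b \<in> support_set v scale y" "v b \<noteq> Infty" "Fin \<gamma> \<le> v b"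
      using \<gamma> unfolding cut_left_cut_plus_finite_values by blast
    \<comment> \<open>\<open>c\<close> is the one of smaller value; either choice has value at least
      \<open>Fin \<gamma>\<close>.\<close>
    have "\<exists>c\<in>{a, b}. c \<in> support_set v scale x \<and> c \<in> support_set v scale y"
      using linear[of "v a" "v b"] a(1) b(1) support_set_antimono[OF a(1), of b]
        support_set_antimono[OF b(1), of a]
      by (auto simp: support_set_def)
    then obtain c where "c \<in> {a, b}" "c \<in> support_set v scale (x + y)"
      using support_set_add by blast
    then show ?thesis
      using a(2,3) b(2,3) unfolding cut_left_cut_plus_finite_values by blast
  qed
  then have "min (?A x) (?A y) \<le> ?A (x + y)"
    using linear[of "?A x" "?A y"] by (auto simp: min_def less_eq_cut_def)
  then show ?thesis
    using False by (auto simp: induced_quasi_valuation_def min_def split: if_splits)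
qed

end

theorem theorem9p19:
  fixes v :: "'f::field \<Rightarrow> 'g::linordered_ab_group_add with_infty"
    and scale :: "'f \<Rightarrow> 'r::{ring, monoid_mult} \<Rightarrow> 'r"
  assumes "valuation v"
    and "algebra_over (valuation_ring v) scale"
  shows "quasi_valuation (induced_quasi_valuation v scale)"
proof -
  interpret valued_algebra v scale
    using assms by (rule valued_algebra.intro)
  show ?thesis
    unfolding quasi_valuation_def
    using induced_quasi_valuation_mult induced_quasi_valuation_add
    \<comment> \<open>Only the value at 0 is read off from the definition; the other two clauses
      keep the form of the lemmas.\<close>
    by (simp add: induced_quasi_valuation_def[of _ _ 0])
qed

end
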